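(* Let $T$ be an operator of class $\mathcal{NL}$ on a complex Hilbert space $\mathcal{H}$. Then $T$ has closed range if and only if $0$ is not a limit point of the spectrum $\sigma(T)$.
   Context: An operator is a bounded linear transformation of a Hilbert space into itself. $\mathcal{N}(T)$ denotes the kernel of $T$. The residual spectrum $\sigma_R(S)$ of an operator $S$ is the set of $\lambda\in\mathbb{C}$ such that $S-\lambda I$ is injective but its range is not dense. An operator $S$ is isoloid if every isolated point of its spectrum $\sigma(S)$ is an eigenvalue of $S$. An operator $T$ is of class $\mathcal{NL}$ if all of the following hold: (i) $\mathcal{N}(T)$ reduces $T$ (i.e. $\mathcal{N}(T)$ and $\mathcal{N}(T)^\perp$ are both invariant for $T$); (ii) $0\notin\sigma_R\big(T|_{\mathcal{N}(T)^\perp}\big)$; (iii) $T|_{\mathcal{N}(T)^\perp}$ is isoloid. Here $T|_{\mathcal{N}(T)^\perp}$ is regarded as an operator on the Hilbert space $\mathcal{N}(T)^\perp$. *)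

theory Defs
  imports "HOL-Analysis.Analysis"
begin

text \<open>
  Complex inner product spaces and complex Hilbert spaces, on top of the normed spaces of
  \<open>HOL-Analysis\<close>. The inner product is linear in the first argument.
\<close>

class complex_inner = real_normed_vector +
  fixes scaleC :: "complex \<Rightarrow> 'a \<Rightarrow> 'a" (infixr "*\<^sub>C" 75)
    and cinner :: "'a \<Rightarrow> 'a \<Rightarrow> complex"
  assumes scaleC_add_right: "c *\<^sub>C (x + y) = c *\<^sub>C x + c *\<^sub>C y"
    and scaleC_add_left: "(c + d) *\<^sub>C x = c *\<^sub>C x + d *\<^sub>C x"
    and scaleC_scaleC: "c *\<^sub>C (d *\<^sub>C x) = (c * d) *\<^sub>C x"
    and scaleC_one: "1 *\<^sub>C x = x"
    and scaleR_scaleC: "r *\<^sub>R x = complex_of_real r *\<^sub>C x"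
    and cinner_commute: "cinner x y = cnj (cinner y x)"
    and cinner_add_left: "cinner (x + y) z = cinner x z + cinner y z"
    and cinner_scaleC_left: "cinner (c *\<^sub>C x) y = c * cinner x y"
    and cinner_self: "cinner x x = complex_of_real ((norm x)\<^sup>2)"

class complex_hilbert_space = complex_inner + complete_space

instantiation complex :: complex_hilbert_space
begin

definition scaleC_complex :: "complex \<Rightarrow> complex \<Rightarrow> complex"
  where "scaleC_complex c z = c * z"

definition cinner_complex :: "complex \<Rightarrow> complex \<Rightarrow> complex"
  where "cinner_complex z w = z * cnj w"

instance
  by standard
    (auto simp: scaleC_complex_def cinner_complex_def algebra_simps scaleR_conv_of_real
      simp flip: complex_norm_square)

end

text \<open>
  A closed subspace \<open>M\<close> of a Hilbert space is itself a Hilbert space. Operators on it are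
  functions on the ambient type of which only the values on \<open>M\<close> matter, and every notion below
  takes \<open>M\<close> as a parameter: the restriction of \<open>T\<close> to \<open>M\<close> is \<open>T\<close> considered on \<open>M\<close>, and the
  whole Hilbert space is the case \<open>M = UNIV\<close>.
\<close>

definition operator_on :: "'a::complex_inner set \<Rightarrow> ('a \<Rightarrow> 'a) \<Rightarrow> bool" where
  "operator_on M S \<longleftrightarrow>
     S ` M \<subseteq> M \<and>
     (\<forall>x\<in>M. \<forall>y\<in>M. S (x + y) = S x + S y) \<and>
     (\<forall>c. \<forall>x\<in>M. S (c *\<^sub>C x) = c *\<^sub>C S x) \<and>
     (\<exists>K. \<forall>x\<in>M. norm (S x) \<le> K * norm x)"

definition invertible_on :: "'a::complex_inner set \<Rightarrow> ('a \<Rightarrow> 'a) \<Rightarrow> bool" where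
  "invertible_on M S \<longleftrightarrow>
     (\<exists>R. operator_on M R \<and> (\<forall>x\<in>M. R (S x) = x \<and> S (R x) = x))"

definition spectrum_on :: "'a::complex_inner set \<Rightarrow> ('a \<Rightarrow> 'a) \<Rightarrow> complex set" where
  "spectrum_on M S = {l. \<not> invertible_on M (\<lambda>x. S x - l *\<^sub>C x)}"

text \<open>Density of the range is density in \<open>M\<close>.\<close>

definition residual_spectrum_on :: "'a::complex_inner set \<Rightarrow> ('a \<Rightarrow> 'a) \<Rightarrow> complex set" where
  "residual_spectrum_on M S =
     {l. inj_on (\<lambda>x. S x - l *\<^sub>C x) M \<and> \<not> M \<subseteq> closure ((\<lambda>x. S x - l *\<^sub>C x) ` M)}"

definition eigenvalue_on :: "'a::complex_inner set \<Rightarrow> ('a \<Rightarrow> 'a) \<Rightarrow> complex \<Rightarrow> bool" where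
  "eigenvalue_on M S l \<longleftrightarrow> (\<exists>x\<in>M. x \<noteq> 0 \<and> S x = l *\<^sub>C x)"

definition isoloid_on :: "'a::complex_inner set \<Rightarrow> ('a \<Rightarrow> 'a) \<Rightarrow> bool" where
  "isoloid_on M S \<longleftrightarrow> (\<forall>l. l isolated_in spectrum_on M S \<longrightarrow> eigenvalue_on M S l)"

definition kernel :: "('a::complex_inner \<Rightarrow> 'a) \<Rightarrow> 'a set" where
  "kernel T = {x. T x = 0}"

definition orth_complement :: "'a::complex_inner set \<Rightarrow> 'a set" where
  "orth_complement A = {y. \<forall>x\<in>A. cinner x y = 0}"

definition reduces :: "'a::complex_inner set \<Rightarrow> ('a \<Rightarrow> 'a) \<Rightarrow> bool" where
  "reduces M T \<longleftrightarrow> T ` M \<subseteq> M \<and> T ` orth_complement M \<subseteq> orth_complement M"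

definition class_NL :: "('a::complex_inner \<Rightarrow> 'a) \<Rightarrow> bool" where
  "class_NL T \<longleftrightarrow>
     reduces (kernel T) T \<and>
     0 \<notin> residual_spectrum_on (orth_complement (kernel T)) T \<and>
     isoloid_on (orth_complement (kernel T)) T"

end

theory Submission
  imports Defs
begin

text \<open>
  Write \<open>N\<close> for the kernel of \<open>T\<close> and \<open>M\<close> for its orthogonal complement. Since \<open>N\<close> reduces
  \<open>T\<close>, the operator splits as the zero operator on \<open>N\<close> and an injective operator \<open>T\<^sub>1\<close> on \<open>M\<close>,
  and all of the range of \<open>T\<close> comes from \<open>T\<^sub>1\<close>. Both sides of the equivalence say that \<open>T\<^sub>1\<close> is
  invertible on \<open>M\<close>.

  If the range is closed, it is all of \<open>M\<close>: as \<open>T\<^sub>1\<close> is injective and \<open>0\<close> is not in its residual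
  spectrum, its range is dense in \<open>M\<close>. To avoid operators between subspaces, the resulting
  invertibility is expressed by the operator \<open>T + P\<close> on the whole space, where \<open>P\<close> is the
  orthogonal projection onto \<open>N\<close>: it is the identity on \<open>N\<close> and \<open>T\<^sub>1\<close> on \<open>M\<close>, hence bijective
  (\<open>bij_T_add_P\<close>). By the open mapping theorem it has a bounded inverse, so \<open>T + P - l\<close> stays
  bijective for small \<open>l\<close> (\<open>bij_perturb_scaleC\<close>). On \<open>M\<close> this operator agrees with \<open>T - l\<close>, while on
  \<open>N\<close> the operator \<open>T - l\<close> is the scalar \<open>- l\<close>; so for small \<open>l \<noteq> 0\<close> also \<open>T - l\<close> is bijective
  (\<open>bij_T_diff_scaleC\<close>), and \<open>0\<close> is at most an isolated point of the spectrum.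

  Conversely, the nonzero part of the spectrum of \<open>T\<^sub>1\<close> lies in the spectrum of \<open>T\<close>
  (\<open>spectrum_on_M_subset\<close>). So if \<open>0\<close> is not a limit point of the latter, it is either outside the
  spectrum of \<open>T\<^sub>1\<close> or isolated in it. In the second case it would be an eigenvalue of the isoloid
  operator \<open>T\<^sub>1\<close>, which is injective. Hence \<open>T\<^sub>1\<close> is invertible and the range of \<open>T\<close> is the closed
  subspace \<open>M\<close>.

  The facts about Hilbert spaces behind this are the bounded inverse theorem
  (\<open>bounded_linear_inv\<close>) and the existence of orthogonal projections
  (\<open>orthogonal_projection\<close>).
\<close>

section \<open>The open mapping theorem\<close>

text \<open>
  By Baire, since the closures of the images of the balls of radius \<open>n\<close> cover the complete
  codomain, one of them contains a ball; after moving that ball to the origin and rescaling,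
  every point is reached up to half of its norm, which is the start of a successive approximation.
\<close>

lemma surj_imp_approx_preimage:
  fixes f :: "'a::real_normed_vector \<Rightarrow> 'b::banach"
  assumes f: "bounded_linear f" and surj: "surj f"
  shows "\<exists>C\<ge>0. \<forall>y. \<exists>x. norm x \<le> C * norm y \<and> norm (y - f x) \<le> norm y / 2"
proof -
  interpret bounded_linear f by fact
  define E where "E n = closure (f ` cball 0 (real n))" for n
  have "y \<in> \<Union>(range E)" for y
  proof -
    obtain x where "y = f x"
      using surj by blast
    then have "y \<in> E (nat \<lceil>norm x\<rceil>)"
      unfolding E_def by (intro closure_subset [THEN subsetD]) (auto simp: of_nat_ceiling)
    then show ?thesis
      by blast
  qed
  then have "\<Union>(range E) = UNIV"
    by blast
  moreover have "interior (\<Union>(range E)) = {}" if "\<And>n. interior (E n) = {}"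
  proof -
    have "Met_TC.mtopology interior_of \<Union>(range E) = {}"
    proof (rule Met_TC.metric_Baire_category_alt)
      fix A
      assume "A \<in> range E"
      then show "closedin Met_TC.mtopology A \<and> Met_TC.mtopology interior_of A = {}"
        using that by (auto simp: E_def)
    qed (auto simp: complete_UNIV)
    then show ?thesis
      by simp
  qed
  ultimately obtain n where "interior (E n) \<noteq> {}"
    by auto
  then obtain y0 r where r: "r > 0" and ball: "ball y0 r \<subseteq> E n"
    by (metis all_not_in_conv mem_interior)
  show ?thesis
  proof (intro exI [of _ "4 * real n / r"] conjI allI)
    show "0 \<le> 4 * real n / r"
      using r by simp
    fix y
    show "\<exists>x. norm x \<le> 4 * real n / r * norm y \<and> norm (y - f x) \<le> norm y / 2"
    proof (cases "y = 0")
      case True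
      then show ?thesis
        by (intro exI [of _ 0]) (simp add: zero)
    next
      case False
      define t where "t = r / (2 * norm y)"
      have t: "t > 0" and ty: "t * norm y = r / 2"
        using r False by (auto simp: t_def)
      \<comment> \<open>The scaling makes \<open>t y\<close> have norm \<open>r / 2\<close>. Both the centre \<open>y0\<close> and \<open>y0 + t y\<close> are images
        up to \<open>r / 8\<close>, so their difference \<open>t y\<close> is one up to \<open>r / 4\<close>, half of its norm.\<close>
      have "y0 \<in> E n" "y0 + t *\<^sub>R y \<in> E n"
        using ball r t ty by (auto simp: dist_norm subset_iff)
      then obtain u v where u: "norm u \<le> n" "dist (f u) (y0 + t *\<^sub>R y) < r / 8"
        and v: "norm v \<le> n" "dist (f v) y0 < r / 8"
        unfolding E_def closure_approachable using r
        by (auto dest!: spec [of _ "r/8"])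
      have eq: "t *\<^sub>R y - f (u - v) = (f v - y0) - (f u - (y0 + t *\<^sub>R y))"
        by (simp add: diff)
      have "norm (t *\<^sub>R y - f (u - v)) \<le> r / 4"
        unfolding eq using u v norm_triangle_ineq4 [of "f v - y0" "f u - (y0 + t *\<^sub>R y)"]
        by (simp add: dist_norm)
      moreover have "y - f ((1 / t) *\<^sub>R (u - v)) = (1 / t) *\<^sub>R (t *\<^sub>R y - f (u - v))"
        using t by (simp only: scaleR) (simp add: scaleR_diff_right)
      ultimately have "norm (y - f ((1 / t) *\<^sub>R (u - v))) \<le> (1 / t) * (r / 4)"
        using t mult_left_mono [of "norm (t *\<^sub>R y - f (u - v))" "r / 4" "1 / t"] by simp
      also have "\<dots> = norm y / 2"
        using r False by (simp add: t_def)
      finally have 1: "norm (y - f ((1 / t) *\<^sub>R (u - v))) \<le> norm y / 2" .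
      have "norm (u - v) \<le> 2 * n"
        using u v norm_triangle_ineq4 [of u v] by simp
      then have "norm ((1 / t) *\<^sub>R (u - v)) \<le> (1 / t) * (2 * n)"
        using t mult_left_mono [of "norm (u - v)" "2 * real n" "1 / t"] by simp
      also have "\<dots> = 4 * real n / r * norm y"
        using r False by (simp add: t_def)
      finally show ?thesis
        using 1 by blast
    qed
  qed
qed

text \<open>
  The error left by an approximate preimage is again approximated, and so on: the errors halve in
  each round, so the approximate preimages form an absolutely convergent series whose sum is an
  exact preimage.
\<close>

lemma surj_imp_bounded_preimage:
  fixes f :: "'a::banach \<Rightarrow> 'b::banach"
  assumes f: "bounded_linear f" and surj: "surj f"
  shows "\<exists>C. \<forall>y. \<exists>x. f x = y \<and> norm x \<le> C * norm y"
proof -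
  interpret bounded_linear f by fact
  obtain C where C: "C \<ge> 0"
    and "\<And>y. \<exists>x. norm x \<le> C * norm y \<and> norm (y - f x) \<le> norm y / 2"
    using surj_imp_approx_preimage [OF f surj] by blast
  then obtain g where g: "\<And>y. norm (g y) \<le> C * norm y"
    and fg: "\<And>y. norm (y - f (g y)) \<le> norm y / 2"
    by metis
  have "\<exists>x. f x = y \<and> norm x \<le> 2 * C * norm y" for y
  proof -
    define s where "s k = ((\<lambda>z. z - f (g z)) ^^ k) y" for k
    have s_0: "s 0 = y" and s_Suc: "s (Suc k) = s k - f (g (s k))" for k
      by (simp_all add: s_def)
    have s_le: "norm (s k) \<le> norm y * (1 / 2) ^ k" for k
    proof (induction k)
      case (Suc k)
      then show ?case
        using fg [of "s k"] by (simp add: s_Suc)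
    qed (simp add: s_0)
    have gs_le: "norm (g (s k)) \<le> C * norm y * (1 / 2) ^ k" for k
      using order_trans [OF g mult_left_mono [OF s_le C]] by (simp add: mult.assoc)
    have geo: "(\<lambda>k. C * norm y * (1 / 2) ^ k) sums (C * norm y * 2)"
      using sums_mult [OF geometric_sums [of "1/2::real"], of "C * norm y"] by simp
    have summ: "summable (\<lambda>k. norm (g (s k)))"
      by (rule summable_comparison_test' [OF sums_summable [OF geo], of 0]) (simp add: gs_le)
    define x where "x = (\<Sum>k. g (s k))"
    have "s \<longlonglongrightarrow> 0"
    proof (rule Lim_null_comparison)
      show "\<forall>\<^sub>F k in sequentially. norm (s k) \<le> norm y * (1 / 2) ^ k"
        by (simp add: s_le)
      show "(\<lambda>k. norm y * (1 / 2) ^ k) \<longlonglongrightarrow> 0"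
        by (intro tendsto_mult_right_zero LIMSEQ_power_zero) simp
    qed
    then have "(\<lambda>k. s k - s (Suc k)) sums (s 0 - 0)"
      by (rule telescope_sums')
    then have "(\<lambda>k. f (g (s k))) sums y"
      by (simp add: s_Suc s_0)
    moreover have "(\<lambda>k. f (g (s k))) sums f x"
      unfolding x_def by (rule sums [OF summable_sums [OF summable_norm_cancel [OF summ]]])
    ultimately have "f x = y"
      by (metis sums_unique2)
    moreover have "norm x \<le> (\<Sum>k. norm (g (s k)))"
      unfolding x_def by (rule summable_norm [OF summ])
    moreover have "\<dots> \<le> C * norm y * 2"
      using suminf_le [OF gs_le summ sums_summable [OF geo]] sums_unique [OF geo] by simp
    ultimately show ?thesis
      by (auto simp: mult_ac)
  qed
  then show ?thesis
    by (intro exI [of _ "2 * C"] allI)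
qed

theorem bounded_linear_inv:
  fixes f :: "'a::banach \<Rightarrow> 'b::banach"
  assumes f: "bounded_linear f" and bij: "bij f"
  shows "bounded_linear (inv f)"
proof -
  interpret bounded_linear f by fact
  obtain C where C: "\<And>y. \<exists>x. f x = y \<and> norm x \<le> C * norm y"
    using surj_imp_bounded_preimage [OF f bij_is_surj [OF bij]] by blast
  have inj: "inj f" and finv: "f (inv f y) = y" for y
    using bij by (auto simp: bij_is_inj bij_is_surj surj_f_inv_f)
  show ?thesis
  proof (rule bounded_linear_intro)
    show "inv f (x + y) = inv f x + inv f y" for x y
      by (rule inv_f_eq [OF inj]) (simp add: add finv)
    show "inv f (r *\<^sub>R x) = r *\<^sub>R inv f x" for r x
      by (rule inv_f_eq [OF inj]) (simp add: scaleR finv)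
    show "norm (inv f y) \<le> norm y * C" for y
    proof -
      obtain x where "f x = y" "norm x \<le> C * norm y"
        using C by blast
      then show ?thesis
        using inv_f_eq [OF inj, of x y] by (simp add: mult.commute)
    qed
  qed
qed

section \<open>Complex inner product spaces\<close>

instance complex_hilbert_space \<subseteq> banach ..

lemma scaleC_zero_left [simp]: "0 *\<^sub>C x = 0"
  using scaleR_scaleC [of 0 x] by simp

lemma scaleC_minus_one: "(- 1) *\<^sub>C x = - x"
  using scaleR_scaleC [of "-1" x] by simp

lemma scaleC_minus_left: "(- c) *\<^sub>C x = - (c *\<^sub>C x)"
  using scaleC_scaleC [of "-1" c x] by (simp add: scaleC_minus_one)

lemma scaleC_zero_right [simp]: "c *\<^sub>C 0 = 0"
  using scaleC_add_right [of c 0 0] by simp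

lemma scaleC_diff_right: "c *\<^sub>C (x - y) = c *\<^sub>C x - c *\<^sub>C y"
  using scaleC_add_right [of c "x - y" y] by simp

lemma scaleC_eq_0_iff [simp]: "c *\<^sub>C x = 0 \<longleftrightarrow> c = 0 \<or> x = 0"
  by (metis left_inverse scaleC_one scaleC_scaleC scaleC_zero_left scaleC_zero_right)

lemma cinner_scaleC_right: "cinner x (c *\<^sub>C y) = cnj c * cinner x y"
  by (metis cinner_commute cinner_scaleC_left complex_cnj_mult)

lemma cinner_add_right: "cinner x (y + z) = cinner x y + cinner x z"
  by (metis cinner_add_left cinner_commute complex_cnj_add)

lemma cinner_diff_left: "cinner (x - y) z = cinner x z - cinner y z"
  using cinner_add_left [of "x - y" y z] by simp

lemma cinner_diff_right: "cinner x (y - z) = cinner x y - cinner x z"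
  using cinner_add_right [of x "y - z" z] by simp

lemma cinner_zero_left [simp]: "cinner 0 x = 0"
  using cinner_scaleC_left [of 0 0 x] by simp

lemma cinner_zero_right [simp]: "cinner x 0 = 0"
  using cinner_commute [of x 0] by simp

lemma norm_sq_eq_cinner: "(norm x)\<^sup>2 = Re (cinner x x)"
  by (simp add: cinner_self)

lemma norm_scaleC: "norm (c *\<^sub>C x) = cmod c * norm x"
proof -
  have "cinner (c *\<^sub>C x) (c *\<^sub>C x) = of_real ((cmod c * norm x)\<^sup>2)"
    unfolding cinner_scaleC_left cinner_scaleC_right cinner_self [of x] power_mult_distrib
    by (simp only: of_real_mult complex_norm_square mult_ac)
  then have "(norm (c *\<^sub>C x))\<^sup>2 = (cmod c * norm x)\<^sup>2"
    by (simp only: cinner_self of_real_eq_iff)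
  then show ?thesis
    by (simp add: power2_eq_iff_nonneg)
qed

lemma parallelogram:
  fixes x y :: "'a::complex_inner"
  shows "(norm (x + y))\<^sup>2 + (norm (x - y))\<^sup>2 = 2 * (norm x)\<^sup>2 + 2 * (norm y)\<^sup>2"
  by (simp add: norm_sq_eq_cinner cinner_add_left cinner_add_right cinner_diff_left cinner_diff_right)

lemma pythagoras:
  fixes x y :: "'a::complex_inner"
  assumes "cinner x y = 0"
  shows "(norm (x + y))\<^sup>2 = (norm x)\<^sup>2 + (norm y)\<^sup>2"
  using assms cinner_commute [of y x]
  by (simp add: norm_sq_eq_cinner cinner_add_left cinner_add_right)

text \<open>
  Subtracting from \<open>z\<close> its component along \<open>q\<close> shortens it, by Pythagoras, unless that component
  vanishes.
\<close>

lemma norm_minimal_imp_orthogonal: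
  assumes min: "\<And>c. norm z \<le> norm (z - c *\<^sub>C q)"
  shows "cinner q z = 0"
proof (cases "q = 0")
  case False
  define c where "c = cinner z q / cinner q q"
  have q: "cinner q q \<noteq> 0"
    using False by (simp add: cinner_self)
  have 0: "cinner (z - c *\<^sub>C q) (c *\<^sub>C q) = 0"
    using q by (simp add: c_def cinner_diff_left cinner_scaleC_left cinner_scaleC_right)
  have "(norm z)\<^sup>2 = (norm (z - c *\<^sub>C q))\<^sup>2 + (norm (c *\<^sub>C q))\<^sup>2"
    using pythagoras [OF 0] by simp
  moreover have "(norm z)\<^sup>2 \<le> (norm (z - c *\<^sub>C q))\<^sup>2"
    using min by (simp add: power_mono)
  ultimately have "c *\<^sub>C q = 0"
    by simp
  then have "cinner z q = 0"
    using False q by (simp add: c_def)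
  then show ?thesis
    using cinner_commute [of q z] by simp
qed simp

section \<open>Orthogonal projections\<close>

definition csubspace :: "'a::complex_inner set \<Rightarrow> bool" where
  "csubspace N \<longleftrightarrow> 0 \<in> N \<and> (\<forall>x\<in>N. \<forall>y\<in>N. x + y \<in> N) \<and> (\<forall>c. \<forall>x\<in>N. c *\<^sub>C x \<in> N)"

lemma csubspace_diff: "csubspace N \<Longrightarrow> x \<in> N \<Longrightarrow> y \<in> N \<Longrightarrow> x - y \<in> N"
  unfolding csubspace_def using scaleC_minus_one [of y] by (metis diff_conv_add_uminus)

lemma csubspace_orth_complement: "csubspace (orth_complement A)"
  by (auto simp: csubspace_def orth_complement_def cinner_add_right cinner_scaleC_right)

lemma orth_complement_Int: "x \<in> N \<Longrightarrow> x \<in> orth_complement N \<Longrightarrow> x = 0"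
  by (force simp: orth_complement_def cinner_self)

text \<open>
  A minimizing sequence is Cauchy: by the parallelogram law two almost nearest points that lie far
  apart would have a midpoint nearer to \<open>x\<close> than the infimum allows.
\<close>

lemma ex_nearest_point:
  fixes x :: "'a::complex_hilbert_space"
  assumes "closed N" "N \<noteq> {}" and mid: "\<And>p q. p \<in> N \<Longrightarrow> q \<in> N \<Longrightarrow> (1/2) *\<^sub>R (p + q) \<in> N"
  obtains p where "p \<in> N" "\<And>q. q \<in> N \<Longrightarrow> norm (x - p) \<le> norm (x - q)"
proof -
  define D where "D = (INF q\<in>N. (norm (x - q))\<^sup>2)"
  have bdd: "bdd_below ((\<lambda>q. (norm (x - q))\<^sup>2) ` N)"
    by (rule bdd_belowI2 [of _ 0]) simp
  have D_le: "D \<le> (norm (x - q))\<^sup>2" if "q \<in> N" for q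
    unfolding D_def using bdd that by (rule cINF_lower)
  have "\<exists>q\<in>N. (norm (x - q))\<^sup>2 < D + 1 / Suc n" for n
    using cINF_less_iff [OF \<open>N \<noteq> {}\<close> bdd, of "D + 1 / Suc n"] by (simp add: D_def)
  then obtain u where uN: "\<And>n. u n \<in> N" and u: "\<And>n. (norm (x - u n))\<^sup>2 < D + 1 / Suc n"
    by metis
  have dist_u: "(norm (u m - u n))\<^sup>2 < 2 / Suc m + 2 / Suc n" for m n
  proof -
    have "(norm (x - u n + (x - u m)))\<^sup>2 = 4 * (norm (x - (1/2) *\<^sub>R (u m + u n)))\<^sup>2"
    proof -
      have "x - u n + (x - u m) = 2 *\<^sub>R (x - (1/2) *\<^sub>R (u m + u n))"
        by (simp add: scaleR_diff_right scaleR_2)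
      then show ?thesis
        by (simp add: power_mult_distrib)
    qed
    moreover have "D \<le> (norm (x - (1/2) *\<^sub>R (u m + u n)))\<^sup>2"
      by (intro D_le mid uN)
    ultimately show ?thesis
      using parallelogram [of "x - u n" "x - u m"] u [of m] u [of n] by simp
  qed
  have "Cauchy u"
  proof (rule metric_CauchyI)
    fix e :: real
    assume "e > 0"
    then obtain k where k: "inverse (real (Suc k)) < e\<^sup>2 / 4"
      using reals_Archimedean [of "e\<^sup>2 / 4"] by auto
    have "dist (u m) (u n) < e" if "m \<ge> k" "n \<ge> k" for m n
    proof -
      have "1 / real (Suc m) \<le> 1 / real (Suc k)" "1 / real (Suc n) \<le> 1 / real (Suc k)"
        using that by (auto intro!: divide_left_mono)
      then have "(norm (u m - u n))\<^sup>2 < e\<^sup>2"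
        using dist_u [of m n] k by (simp add: inverse_eq_divide)
      then show ?thesis
        using \<open>e > 0\<close> by (auto simp: dist_norm intro: power2_less_imp_less)
    qed
    then show "\<exists>M. \<forall>m\<ge>M. \<forall>n\<ge>M. dist (u m) (u n) < e"
      by blast
  qed
  then obtain p where p: "u \<longlonglongrightarrow> p"
    using Cauchy_convergent convergent_def by blast
  have "(norm (x - p))\<^sup>2 \<le> D + 0"
  proof (rule LIMSEQ_le)
    show "(\<lambda>n. (norm (x - u n))\<^sup>2) \<longlonglongrightarrow> (norm (x - p))\<^sup>2"
      by (intro tendsto_intros p)
    show "(\<lambda>n. D + 1 / Suc n) \<longlonglongrightarrow> D + 0"
      by (intro tendsto_add tendsto_const LIMSEQ_Suc [OF lim_1_over_n])
    show "\<exists>N. \<forall>n\<ge>N. (norm (x - u n))\<^sup>2 \<le> D + 1 / Suc n"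
      using u less_imp_le by blast
  qed
  then have "norm (x - p) \<le> norm (x - q)" if "q \<in> N" for q
    using order_trans [OF _ D_le [OF that]] power2_le_imp_le [of "norm (x - p)" "norm (x - q)"] by simp
  moreover have "p \<in> N"
    using closed_sequentially [OF \<open>closed N\<close> uN p] .
  ultimately show thesis
    using that by blast
qed

text \<open>
  The nearest point of \<open>N\<close> is the only one whose difference from \<open>x\<close> is orthogonal to \<open>N\<close>;
  uniqueness of this decomposition makes the nearest point map linear, and Pythagoras makes it a
  contraction.
\<close>

lemma orthogonal_projection:
  fixes N :: "'a::complex_hilbert_space set"
  assumes "closed N" and N: "csubspace N"
  obtains P where "operator_on UNIV P" "\<And>x. P x \<in> N" "\<And>x. x - P x \<in> orth_complement N"
proof -
  have "\<exists>p\<in>N. x - p \<in> orth_complement N" for x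
  proof -
    have mid: "(1/2) *\<^sub>R (p + q) \<in> N" if "p \<in> N" "q \<in> N" for p q
      using N that unfolding csubspace_def scaleR_scaleC by blast
    obtain p where p: "p \<in> N" and min: "\<And>q. q \<in> N \<Longrightarrow> norm (x - p) \<le> norm (x - q)"
      using ex_nearest_point [OF \<open>closed N\<close> _ mid, of x] N unfolding csubspace_def by blast
    have "cinner q (x - p) = 0" if "q \<in> N" for q
    proof (rule norm_minimal_imp_orthogonal)
      fix c
      have "p + c *\<^sub>C q \<in> N"
        using N p that by (simp add: csubspace_def)
      from min [OF this] show "norm (x - p) \<le> norm (x - p - c *\<^sub>C q)"
        by (simp add: diff_diff_eq)
    qed
    then show ?thesis
      using p by (auto simp: orth_complement_def)
  qed
  then obtain P where P: "\<And>x. P x \<in> N" and P': "\<And>x. x - P x \<in> orth_complement N"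
    by metis
  have unique: "P x = p" if "p \<in> N" "x - p \<in> orth_complement N" for x p
  proof -
    have "P x - p \<in> N"
      using N P that by (simp add: csubspace_diff)
    moreover have "P x - p = (x - p) - (x - P x)"
      by simp
    then have "P x - p \<in> orth_complement N"
      using csubspace_diff [OF csubspace_orth_complement that(2) P'] by metis
    ultimately show ?thesis
      using orth_complement_Int by fastforce
  qed
  have "P (x + y) = P x + P y" for x y
  proof (rule unique)
    show "P x + P y \<in> N"
      using N P by (simp add: csubspace_def)
    have "x + y - (P x + P y) = (x - P x) + (y - P y)"
      by simp
    then show "x + y - (P x + P y) \<in> orth_complement N"
      using csubspace_orth_complement [of N] P' unfolding csubspace_def by metis
  qed
  moreover have "P (c *\<^sub>C x) = c *\<^sub>C P x" for c x
  proof (rule unique)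
    show "c *\<^sub>C P x \<in> N"
      using N P by (simp add: csubspace_def)
    show "c *\<^sub>C x - c *\<^sub>C P x \<in> orth_complement N"
      using csubspace_orth_complement [of N] P'
      unfolding csubspace_def scaleC_diff_right [symmetric] by blast
  qed
  moreover have "norm (P x) \<le> 1 * norm x" for x
  proof -
    have "cinner (P x) (x - P x) = 0"
      using P P' by (simp add: orth_complement_def)
    from pythagoras [OF this] have "(norm (P x))\<^sup>2 \<le> (norm x)\<^sup>2"
      by simp
    then show ?thesis
      using power2_le_imp_le [of "norm (P x)" "norm x"] by simp
  qed
  ultimately have "operator_on UNIV P"
    unfolding operator_on_def by blast
  then show thesis
    using that P P' by blast
qed

section \<open>Invertible operators\<close>

lemma operator_on_UNIV_imp_bounded_linear:
  assumes "operator_on UNIV T"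
  shows "bounded_linear T"
proof -
  obtain K where "\<And>x. norm (T x) \<le> K * norm x"
    using assms by (auto simp: operator_on_def)
  then show ?thesis
    using assms
    by (intro bounded_linear_intro [of _ K]) (auto simp: operator_on_def scaleR_scaleC mult.commute)
qed

lemma operator_on_add:
  assumes "operator_on UNIV S" "operator_on UNIV T"
  shows "operator_on UNIV (\<lambda>x. S x + T x)"
proof -
  obtain K L where "\<And>x. norm (S x) \<le> K * norm x" "\<And>x. norm (T x) \<le> L * norm x"
    using assms by (auto simp: operator_on_def)
  then have "norm (S x + T x) \<le> (K + L) * norm x" for x
    by (metis add_mono distrib_right norm_triangle_le)
  then show ?thesis
    using assms by (auto simp: operator_on_def scaleC_add_right)
qed

lemma operator_on_scaleC: "operator_on UNIV (\<lambda>x. c *\<^sub>C x)"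
  unfolding operator_on_def
  by (auto simp: scaleC_add_right scaleC_scaleC mult.commute norm_scaleC intro!: exI [of _ "cmod c"])

lemma operator_on_diff_scaleC:
  assumes "operator_on UNIV T"
  shows "operator_on UNIV (\<lambda>x. T x - c *\<^sub>C x)"
proof -
  have "(\<lambda>x. T x - c *\<^sub>C x) = (\<lambda>x. T x + (- c) *\<^sub>C x)"
    by (simp add: scaleC_minus_left)
  then show ?thesis
    using operator_on_add [OF assms operator_on_scaleC] by simp
qed

lemma invertible_on_UNIV_if_bij:
  fixes T :: "'a::complex_hilbert_space \<Rightarrow> 'a"
  assumes T: "operator_on UNIV T" and bij: "bij T"
  shows "invertible_on UNIV T"
proof -
  have finv: "T (inv T y) = y" "inv T (T y) = y" for y
    using bij by (auto simp: bij_is_inj bij_is_surj surj_f_inv_f)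
  interpret bounded_linear "inv T"
    by (intro bounded_linear_inv operator_on_UNIV_imp_bounded_linear T bij)
  have "inv T (c *\<^sub>C x) = c *\<^sub>C inv T x" for c x
    using T by (intro inv_f_eq bij_is_inj bij) (simp add: operator_on_def finv)
  then have "operator_on UNIV (inv T)"
    using bounded by (auto simp: operator_on_def add mult.commute)
  then show ?thesis
    using finv by (auto simp: invertible_on_def)
qed

text \<open>
  The equation \<open>S x - l x = y\<close> is the fixed point equation \<open>x = S\<^sup>-\<^sup>1 (y + l x)\<close>, whose right-hand side
  is a contraction in \<open>x\<close> once \<open>\<bar>l\<bar>\<close> is below the reciprocal of a bound for \<open>S\<^sup>-\<^sup>1\<close>.
\<close>

lemma bij_perturb_scaleC:
  fixes S :: "'a::complex_hilbert_space \<Rightarrow> 'a"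
  assumes S: "operator_on UNIV S" and bij: "bij S"
  obtains e where "e > 0" "\<And>l. cmod l < e \<Longrightarrow> bij (\<lambda>x. S x - l *\<^sub>C x)"
proof -
  interpret inv: bounded_linear "inv S"
    by (intro bounded_linear_inv operator_on_UNIV_imp_bounded_linear S bij)
  obtain K where K: "K > 0" "\<And>y. norm (inv S y) \<le> norm y * K"
    using inv.pos_bounded by blast
  show thesis
  proof
    show "inverse K > 0"
      using K by simp
    fix l :: complex
    assume l: "cmod l < inverse K"
    have "\<exists>!x. S x - l *\<^sub>C x = y" for y
    proof -
      have "\<exists>!x. inv S (y + l *\<^sub>C x) = x"
      proof (rule banach_fix_type)
        show "cmod l * K < 1"
          using l K by (simp add: field_simps)
        show "\<forall>x x'. dist (inv S (y + l *\<^sub>C x)) (inv S (y + l *\<^sub>C x')) \<le> cmod l * K * dist x x'"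
        proof (intro allI)
          fix x x'
          have "dist (inv S (y + l *\<^sub>C x)) (inv S (y + l *\<^sub>C x')) = norm (inv S (l *\<^sub>C (x - x')))"
            unfolding dist_norm inv.diff [symmetric] by (simp add: scaleC_diff_right)
          also have "\<dots> \<le> cmod l * K * dist x x'"
            using K(2) [of "l *\<^sub>C (x - x')"] by (simp add: norm_scaleC dist_norm mult_ac)
          finally show "dist (inv S (y + l *\<^sub>C x)) (inv S (y + l *\<^sub>C x')) \<le> cmod l * K * dist x x'" .
        qed
      qed (use K in simp)
      moreover have "inv S (y + l *\<^sub>C x) = x \<longleftrightarrow> S x - l *\<^sub>C x = y" for x
        using bij by (metis bij_inv_eq_iff diff_add_cancel add_diff_cancel_right')
      ultimately show ?thesis
        by simp
    qed
    then show "bij (\<lambda>x. S x - l *\<^sub>C x)"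
      by (simp add: bij_iff)
  qed
qed

section \<open>The reducing kernel\<close>

text \<open>
  The setting of the proof: \<open>P\<close> is the orthogonal projection onto the kernel of \<open>T\<close>. That the kernel
  reduces \<open>T\<close> amounts to \<open>P T = 0 = T P\<close>, and membership in the complement \<open>M\<close> of the kernel to
  \<open>P x = 0\<close>, which turns the arguments about the two summands into calculations with \<open>P\<close>.
\<close>

locale reducing_kernel =
  fixes T P :: "'a::complex_hilbert_space \<Rightarrow> 'a"
  assumes T: "operator_on UNIV T"
    and P: "operator_on UNIV P"
    and P_in: "P x \<in> kernel T"
    and diff_P_in: "x - P x \<in> orth_complement (kernel T)"
    and reduces: "reduces (kernel T) T"
begin

abbreviation "M \<equiv> orth_complement (kernel T)"

lemma T_linear: "T (x + y) = T x + T y" "T (x - y) = T x - T y" "T (c *\<^sub>C x) = c *\<^sub>C T x"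
  "T 0 = 0"
  using T linear_diff [OF bounded_linear.linear [OF operator_on_UNIV_imp_bounded_linear [OF T]]]
    linear_0 [OF bounded_linear.linear [OF operator_on_UNIV_imp_bounded_linear [OF T]]]
  by (auto simp: operator_on_def)

lemma P_linear: "P (x + y) = P x + P y" "P (x - y) = P x - P y" "P (c *\<^sub>C x) = c *\<^sub>C P x"
  "P 0 = 0"
  using P linear_diff [OF bounded_linear.linear [OF operator_on_UNIV_imp_bounded_linear [OF P]]]
    linear_0 [OF bounded_linear.linear [OF operator_on_UNIV_imp_bounded_linear [OF P]]]
  by (auto simp: operator_on_def)

lemma T_P [simp]: "T (P x) = 0"
  using P_in by (simp add: kernel_def)

lemma in_M_iff: "x \<in> M \<longleftrightarrow> P x = 0"
proof
  assume "x \<in> M"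
  then have "x - (x - P x) \<in> M"
    using csubspace_diff csubspace_orth_complement diff_P_in by blast
  then show "P x = 0"
    using orth_complement_Int [OF P_in] by simp
next
  assume "P x = 0"
  then show "x \<in> M"
    using diff_P_in [of x] by simp
qed

lemma P_eq_self_iff: "P x = x \<longleftrightarrow> T x = 0"
proof
  assume "T x = 0"
  then have "x - P x \<in> kernel T"
    by (simp add: kernel_def T_linear)
  then show "P x = x"
    using orth_complement_Int diff_P_in by fastforce
qed (metis T_P)

lemma P_P [simp]: "P (P x) = P x"
  by (simp add: P_eq_self_iff)

lemma T_in_M: "T x \<in> M"
proof -
  have "T (x - P x) \<in> M"
    using reduces diff_P_in by (auto simp: reduces_def)
  then show ?thesis
    by (simp add: T_linear)
qed

lemma P_T [simp]: "P (T x) = 0"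
  using T_in_M by (simp add: in_M_iff)

lemma closed_M: "closed M"
proof -
  have "continuous_on UNIV P"
    by (intro linear_continuous_on operator_on_UNIV_imp_bounded_linear P)
  then have "closed {x. P x = 0}"
    by (intro closed_Collect_eq continuous_on_const)
  moreover have "M = {x. P x = 0}"
    using in_M_iff by blast
  ultimately show ?thesis
    by metis
qed

text \<open>
  The inverse of \<open>T - l\<close> for \<open>l \<noteq> 0\<close> maps \<open>M\<close> into itself, so it restricts to an inverse on \<open>M\<close>.
\<close>

lemma spectrum_on_M_subset: "spectrum_on M T - {0} \<subseteq> spectrum_on UNIV T"
proof
  fix l
  assume "l \<in> spectrum_on M T - {0}"
  then have l: "l \<in> spectrum_on M T" "l \<noteq> 0"
    by auto
  show "l \<in> spectrum_on UNIV T"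
  proof (rule ccontr)
    assume "l \<notin> spectrum_on UNIV T"
    then obtain R where R: "operator_on UNIV R" and RT: "\<And>x. R (T x - l *\<^sub>C x) = x"
      and TR: "\<And>x. T (R x) - l *\<^sub>C R x = x"
      by (auto simp: spectrum_on_def invertible_on_def)
    \<comment> \<open>Applying \<open>P\<close> to \<open>(T - l) R x = x\<close> leaves \<open>- l P R x = P x\<close>.\<close>
    have "R x \<in> M" if "x \<in> M" for x
      using TR [of x] that l P_linear(2) [of "T (R x)" "l *\<^sub>C R x"]
      by (simp add: in_M_iff P_linear)
    then have "operator_on M R"
      using R by (auto simp: operator_on_def)
    then show False
      using l RT TR by (auto simp: spectrum_on_def invertible_on_def)
  qed
qed

text \<open>
  If \<open>0\<close> were in the spectrum on \<open>M\<close>, it would be isolated there and hence an eigenvalue; but no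
  nonzero vector of \<open>M\<close> lies in the kernel. So \<open>T\<close> maps \<open>M\<close> onto \<open>M\<close>, and \<open>M\<close> is closed.
\<close>

lemma closed_range_if_not_islimpt:
  assumes iso: "isoloid_on M T" and lim: "\<not> 0 islimpt spectrum_on UNIV T"
  shows "closed (range T)"
proof -
  have "\<not> 0 islimpt spectrum_on M T"
    using lim islimpt_subset [OF _ spectrum_on_M_subset] islimpt_punctured by blast
  moreover have "\<not> eigenvalue_on M T 0"
    unfolding eigenvalue_on_def by (metis P_eq_self_iff in_M_iff scaleC_zero_left)
  ultimately have "0 \<notin> spectrum_on M T"
    using iso by (auto simp: isoloid_on_def isolated_in_islimpt_iff)
  then have "M \<subseteq> range T"
    by (auto simp: spectrum_on_def invertible_on_def) (metis rangeI)
  then have "range T = M"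
    using T_in_M by blast
  then show ?thesis
    using closed_M by simp
qed

text \<open>
  As \<open>T\<close> is injective on \<open>M\<close>, the only way for \<open>0\<close> to avoid the residual spectrum is that the image
  of \<open>M\<close> is dense in \<open>M\<close>; the closed range therefore contains \<open>M\<close>.
\<close>

lemma range_eq_M_if_closed:
  assumes res: "0 \<notin> residual_spectrum_on M T" and closed: "closed (range T)"
  shows "range T = M"
proof -
  have "inj_on T M"
  proof (rule inj_onI)
    fix x y
    assume xy: "x \<in> M" "y \<in> M" "T x = T y"
    then have "x - y \<in> kernel T"
      by (simp add: kernel_def T_linear)
    then show "x = y"
      using xy csubspace_diff csubspace_orth_complement orth_complement_Int by fastforce
  qed
  then have "M \<subseteq> closure (T ` M)"
    using res by (simp add: residual_spectrum_on_def)
  also have "\<dots> \<subseteq> range T"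
    by (intro closure_minimal closed) auto
  finally show ?thesis
    using T_in_M by blast
qed

text \<open>
  Adding \<open>P\<close> replaces the zero operator on the kernel by the identity, so bijectivity of \<open>T\<close> on \<open>M\<close>
  becomes bijectivity on the whole space.
\<close>

lemma bij_T_add_P:
  assumes range: "range T = M"
  shows "bij (\<lambda>x. T x + P x)"
proof (rule bijI)
  show "inj (\<lambda>x. T x + P x)"
  proof (rule injI)
    fix x y
    assume "T x + P x = T y + P y"
    then have eq: "T (x - y) + P (x - y) = 0"
      by (simp add: T_linear P_linear algebra_simps)
    then have "P (T (x - y) + P (x - y)) = 0"
      by (simp only: P_linear)
    then have "P (x - y) = 0"
      by (simp only: P_linear(1) P_T P_P add_0)
    moreover from this eq have "T (x - y) = 0"
      by simp
    ultimately show "x = y"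
      using P_eq_self_iff [of "x - y"] by simp
  qed
  show "surj (\<lambda>x. T x + P x)"
    unfolding surj_def
  proof
    fix y
    obtain z where "T z = y - P y"
      using range diff_P_in by (metis rangeE)
    \<comment> \<open>The part of \<open>z\<close> in the kernel is exchanged for that of \<open>y\<close>.\<close>
    then have "T (z - P z + P y) + P (z - P z + P y) = y"
      by (simp add: T_linear P_linear)
    then show "\<exists>x. y = T x + P x"
      by metis
  qed
qed

text \<open>
  On \<open>M\<close> both operators coincide. On the kernel they are the scalars \<open>1 - l\<close> and \<open>- l\<close>; \<open>l \<noteq> 0\<close> makes
  the second one invertible, and \<open>l \<noteq> 1\<close> ensures that the solution of the first equation for a
  right-hand side in \<open>M\<close> has no component in the kernel.
\<close>

lemma bij_T_diff_scaleC:
  assumes bij: "bij (\<lambda>x. T x + P x - l *\<^sub>C x)" and l: "l \<noteq> 0" "l \<noteq> 1"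
  shows "bij (\<lambda>x. T x - l *\<^sub>C x)"
proof (rule bijI)
  show "inj (\<lambda>x. T x - l *\<^sub>C x)"
  proof (rule injI)
    fix x y
    assume "T x - l *\<^sub>C x = T y - l *\<^sub>C y"
    then have eq: "T (x - y) = l *\<^sub>C (x - y)"
      by (simp add: T_linear scaleC_diff_right algebra_simps)
    then have "l *\<^sub>C P (x - y) = 0"
      by (metis P_T P_linear(3))
    then have "P (x - y) = 0"
      using l by simp
    with eq have "T (x - y) - l *\<^sub>C (x - y) + P (x - y) = 0"
      by simp
    moreover have "T (x - y) - l *\<^sub>C (x - y) + P (x - y)
        = (T x + P x - l *\<^sub>C x) - (T y + P y - l *\<^sub>C y)"
      by (simp add: T_linear P_linear scaleC_diff_right)
    ultimately have "T x + P x - l *\<^sub>C x = T y + P y - l *\<^sub>C y"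
      by simp
    then show "x = y"
      by (rule injD [OF bij_is_inj [OF bij]])
  qed
  show "surj (\<lambda>x. T x - l *\<^sub>C x)"
    unfolding surj_def
  proof
    fix y
    obtain w where "y - P y = T w + P w - l *\<^sub>C w"
      by (rule surjE [OF bij_is_surj [OF bij]])
    note w = this [symmetric]
    \<comment> \<open>Applying \<open>P\<close> gives \<open>(1 - l) P w = 0\<close>.\<close>
    have "P (T w + P w - l *\<^sub>C w) = 0"
      by (simp add: w P_linear)
    then have "P w + (- 1) *\<^sub>C (l *\<^sub>C P w) = 0"
      by (simp add: P_linear scaleC_minus_one)
    then have "(1 + (- 1) * l) *\<^sub>C P w = 0"
      by (simp only: scaleC_add_left scaleC_one scaleC_scaleC)
    then have "P w = 0"
      using l by simp
    then have "T (w - inverse l *\<^sub>C P y) - l *\<^sub>C (w - inverse l *\<^sub>C P y) = y"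
      using w l by (simp add: T_linear scaleC_diff_right scaleC_scaleC scaleC_one algebra_simps)
    then show "\<exists>x. y = T x - l *\<^sub>C x"
      by metis
  qed
qed

lemma not_islimpt_if_closed_range:
  assumes res: "0 \<notin> residual_spectrum_on M T" and closed: "closed (range T)"
  shows "\<not> 0 islimpt spectrum_on UNIV T"
proof -
  obtain e where e: "e > 0" "\<And>l. cmod l < e \<Longrightarrow> bij (\<lambda>x. T x + P x - l *\<^sub>C x)"
    using bij_perturb_scaleC [OF operator_on_add [OF T P] bij_T_add_P]
      range_eq_M_if_closed [OF res closed] by blast
  have "l \<notin> spectrum_on UNIV T" if "cmod l < min e 1" "l \<noteq> 0" for l
  proof -
    have "bij (\<lambda>x. T x - l *\<^sub>C x)"
      using that e by (intro bij_T_diff_scaleC) auto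
    then show ?thesis
      using invertible_on_UNIV_if_bij [OF operator_on_diff_scaleC [OF T]]
      by (simp add: spectrum_on_def)
  qed
  then show ?thesis
    using e(1) unfolding islimpt_approachable
    by (auto simp: dist_norm intro!: exI [of _ "min e 1"])
qed

end

theorem theorem3p1:
  fixes T :: "'a::complex_hilbert_space \<Rightarrow> 'a"
  assumes "operator_on UNIV T"
    and "class_NL T"
  shows "closed (range T) \<longleftrightarrow> \<not> 0 islimpt spectrum_on UNIV T"
proof -
  have bl: "bounded_linear T"
    by (rule operator_on_UNIV_imp_bounded_linear [OF assms(1)])
  have "closed (kernel T)"
    unfolding kernel_def
    by (intro closed_Collect_eq continuous_on_const linear_continuous_on bl)
  moreover have "csubspace (kernel T)"
    using assms(1) linear_0 [OF bounded_linear.linear [OF bl]]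
    by (auto simp: csubspace_def kernel_def operator_on_def)
  ultimately obtain P where P: "operator_on UNIV P" "\<And>x. P x \<in> kernel T"
      "\<And>x. x - P x \<in> orth_complement (kernel T)"
    using orthogonal_projection by metis
  interpret reducing_kernel T P
    using assms P by unfold_locales (auto simp: class_NL_def)
  show ?thesis
    using assms(2) closed_range_if_not_islimpt not_islimpt_if_closed_range
    by (auto simp: class_NL_def)
qed

end
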